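(* Consider the single-phase two-bus system with purely reactive line impedance $Z=0+\mathbf{j}X$, $X>0$, so that its line length is $L_1=|Z|=X$. For the phasor-based control (PBC) closed-loop matrix $$A-BF=\begin{bmatrix}1 & 0 \\ 0 & 1\end{bmatrix}-\begin{bmatrix}X & 0 \\ 0 & \tfrac12X\end{bmatrix}\begin{bmatrix}a & 0 \\ 0 & 2a\end{bmatrix},$$ and likewise for the droop control closed-loop matrix $$A-BF=0-\begin{bmatrix}X & 0\end{bmatrix}\begin{bmatrix}a \\ a\end{bmatrix},$$ increasing the line length $L_1$ reduces the range of stabilizing controller gains $[0,a_{crit}]$. That is, for each of the two models, if $0<L_1<L_1'$ then $a_{crit}(L_1')<a_{crit}(L_1)$, where $a_{crit}(L_1)$ is the critical gain of that model for the line of length $L_1$.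
   Context: The two-bus network is a slack (substation) bus connected by one line to a bus carrying a constant-power load and a controlled distributed energy resource (DER). The line impedance is $r+\mathbf{j}x$ with resistance $r$ and reactance $x$; here $r=0$ and $x=X>0$. The line length is $L_1:=|Z|=\sqrt{r^2+x^2}$. The closed-loop discrete-time dynamics are governed by the matrix $A-BF$, where $B$ is the impedance matrix and $F$ is the controller gain matrix, parametrized by a scalar gain $a\ge 0$. Critical gain: $a_{crit}>0$ is the controller gain $a>0$ that puts the dominant (maximum magnitude) eigenvalue of $A-BF$ on the verge of instability, i.e. the $a>0$ for which $\max_i|\lambda_i(A-BF)|=1$. The range of stabilizing controller gains is $[0,a_{crit}]$. *)

theory Defs
  imports "Jordan_Normal_Form.Spectral_Radius"
begin

definition line_length :: "complex \<Rightarrow> real" where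
  "line_length Z = cmod Z"

definition pbc_closed_loop :: "real \<Rightarrow> real \<Rightarrow> real mat" where
  "pbc_closed_loop X a =
     mat_of_rows_list 2 [[1, 0], [0, 1]]
     - mat_of_rows_list 2 [[X, 0], [0, 1 / 2 * X]] * mat_of_rows_list 2 [[a, 0], [0, 2 * a]]"

definition droop_closed_loop :: "real \<Rightarrow> real \<Rightarrow> real mat" where
  "droop_closed_loop X a =
     0\<^sub>m 1 1 - mat_of_rows_list 2 [[X, 0]] * mat_of_rows_list 1 [[a], [a]]"

(* The closed-loop matrices are real but their eigenvalues are complex in general,
   so the spectrum is taken after embedding the matrix into the complex matrices. *)
definition is_critical_gain :: "(real \<Rightarrow> real mat) \<Rightarrow> real \<Rightarrow> bool" where
  "is_critical_gain M a \<longleftrightarrow> a > 0 \<and> spectral_radius (map_mat complex_of_real (M a)) = 1"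

(* Meaningful only if exactly one critical gain exists. *)
definition critical_gain :: "(real \<Rightarrow> real mat) \<Rightarrow> real" where
  "critical_gain M = (THE a. is_critical_gain M a)"

end

theory Submission
  imports Defs
begin

text \<open>Both closed-loop matrices are scalar multiples of an identity matrix, with sole eigenvalue
  \<open>1 - X a\<close> (PBC) and \<open>- X a\<close> (droop).  The critical gains are therefore \<open>2 / X\<close> and \<open>1 / X\<close>,
  both strictly decreasing in \<open>X\<close>.\<close>

text \<open>A scalar matrix is upper triangular, so its characteristic polynomial is the
  \<open>n\<close>-th power of the linear factor with root \<open>c\<close>. For
  \<open>n = 0\<close> that power is 1 and the spectrum would be empty.\<close>

lemma spectrum_smult_one:
  fixes c :: complex
  assumes "n > 0"
  shows "spectrum (c \<cdot>\<^sub>m 1\<^sub>m n) = {c}"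
proof -
  let ?A = "c \<cdot>\<^sub>m 1\<^sub>m n"
  have A: "?A \<in> carrier_mat n n" by simp
  have "upper_triangular ?A" by auto
  moreover have "diag_mat ?A = replicate n c"
    by (rule nth_equalityI) (auto simp: diag_mat_def)
  ultimately have "char_poly ?A = [:- c, 1:] ^ n"
    using char_poly_upper_triangular[OF A] by (simp add: prod_list_replicate)
  then show ?thesis
    using assms by (auto simp: spectrum_def eigenvalue_root_char_poly[OF A] poly_power)
qed

lemma spectral_radius_smult_one:
  fixes c :: complex
  assumes "n > 0"
  shows "spectral_radius (c \<cdot>\<^sub>m 1\<^sub>m n) = norm c"
  using assms by (simp add: spectral_radius_def spectrum_smult_one)

text \<open>The factors \<open>1 / 2\<close> and \<open>2\<close> cancel, so both diagonal entries
  of the product are \<open>X * a\<close>.\<close>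

lemma pbc_closed_loop_eq: "pbc_closed_loop X a = (1 - X * a) \<cdot>\<^sub>m 1\<^sub>m 2"
  by (rule eq_matI)
    (auto simp: pbc_closed_loop_def mat_of_rows_list_def scalar_prod_def less_2_cases_iff)

text \<open>A row times a column is a 1 by 1 matrix, and the zero in the row removes the second
  gain.\<close>

lemma droop_closed_loop_eq: "droop_closed_loop X a = (- X * a) \<cdot>\<^sub>m 1\<^sub>m 1"
  by (rule eq_matI)
    (auto simp: droop_closed_loop_def mat_of_rows_list_def scalar_prod_def)

lemma map_mat_of_real_smult_one:
  "map_mat complex_of_real (c \<cdot>\<^sub>m 1\<^sub>m n) = complex_of_real c \<cdot>\<^sub>m 1\<^sub>m n"
  by (rule eq_matI) auto

lemma is_critical_gain_pbc_iff:
  assumes "X > 0"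
  shows "is_critical_gain (pbc_closed_loop X) a \<longleftrightarrow> a = 2 / X"
proof -
  have "is_critical_gain (pbc_closed_loop X) a \<longleftrightarrow> a > 0 \<and> \<bar>1 - X * a\<bar> = 1"
    by (simp only: is_critical_gain_def pbc_closed_loop_eq map_mat_of_real_smult_one
        spectral_radius_smult_one[OF zero_less_numeral] norm_of_real)
  \<comment> \<open>The branch \<open>1 - X * a = 1\<close> forces \<open>a = 0\<close>, which
    positivity excludes; the branch with value -1 remains.\<close>
  also have "\<dots> \<longleftrightarrow> a > 0 \<and> X * a = 2"
    using assms by (auto simp: abs_if split: if_splits)
  also have "\<dots> \<longleftrightarrow> a = 2 / X"
    using assms zero_less_mult_pos[of X a] by (auto simp: field_simps)
  finally show ?thesis .
qed

lemma is_critical_gain_droop_iff: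
  assumes "X > 0"
  shows "is_critical_gain (droop_closed_loop X) a \<longleftrightarrow> a = 1 / X"
proof -
  have "is_critical_gain (droop_closed_loop X) a \<longleftrightarrow> a > 0 \<and> \<bar>- X * a\<bar> = 1"
    by (simp only: is_critical_gain_def droop_closed_loop_eq map_mat_of_real_smult_one
        spectral_radius_smult_one[OF less_numeral_extra(1)] norm_of_real)
  \<comment> \<open>Here \<open>X * a\<close> is positive, so the absolute value is
    \<open>X * a\<close> itself.\<close>
  also have "\<dots> \<longleftrightarrow> a = 1 / X"
    using assms zero_less_mult_pos[of X a] by (auto simp: field_simps)
  finally show ?thesis .
qed

theorem proposition1:
  fixes X X' :: real
  assumes "X > 0" and "X' > 0"
    and "line_length (Complex 0 X) < line_length (Complex 0 X')"
  shows "((\<exists>!a. is_critical_gain (pbc_closed_loop X) a)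
        \<and> (\<exists>!a. is_critical_gain (pbc_closed_loop X') a)
        \<and> critical_gain (pbc_closed_loop X') < critical_gain (pbc_closed_loop X)
        \<and> {0..critical_gain (pbc_closed_loop X')} \<subset> {0..critical_gain (pbc_closed_loop X)})
       \<and> ((\<exists>!a. is_critical_gain (droop_closed_loop X) a)
        \<and> (\<exists>!a. is_critical_gain (droop_closed_loop X') a)
        \<and> critical_gain (droop_closed_loop X') < critical_gain (droop_closed_loop X)
        \<and> {0..critical_gain (droop_closed_loop X')} \<subset> {0..critical_gain (droop_closed_loop X)})"
proof -
  \<comment> \<open>The modulus of a purely imaginary number is the absolute value of its imaginary
    part, here positive.\<close>
  have less: "X < X'"
    using assms by (simp add: line_length_def cmod_def)
  \<comment> \<open>The characterizations turn the predicate under \<open>THE\<close> into an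
    equation for \<open>a\<close>, which fixes the value.\<close>
  have "critical_gain (pbc_closed_loop Y) = 2 / Y"
    and "critical_gain (droop_closed_loop Y) = 1 / Y" if "Y > 0" for Y
    using that
    by (simp_all add: critical_gain_def is_critical_gain_pbc_iff is_critical_gain_droop_iff)
  moreover have "2 / X' < 2 / X" and "1 / X' < 1 / X"
    using assms(1,2) less by (simp_all add: field_simps)
  \<comment> \<open>The inclusion is strict because \<open>d\<close> lies only in the larger
    interval.\<close>
  moreover have "{0..c} \<subset> {0..d}" if "0 < c" "c < d" for c d :: real
    using that by auto
  ultimately show ?thesis
    using assms(1,2) by (simp add: is_critical_gain_pbc_iff is_critical_gain_droop_iff)
qed

end
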